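(* For each $n\ge 3$ let $G_n=(V_n,E_n)$ be an Erdős–Rényi random graph with $n$ nodes and edge probability $p_n=\frac{\log\log(n)}{2(n-1)}$, where each node receives tasks at rate $\lambda>0$ and has processing speed $\mu>\lambda$. Let the random graphs $\{G_n\}$ be independent and defined on the same probability space. Fix $\alpha=(2,\lambda,\mu)$ and let $u_n\in V_n$ have maximum degree for each $n$. Then with probability one, there exists an infinite set $\mathcal{M}\subset\mathbb{N}$ such that the servers $\{u_m:m\in\mathcal{M}\}$ have a skewed neighborhood; specifically, $$\lim_{m\to\infty,\ m\in\mathcal{M}}|\mathcal{N}_m^\alpha(u_m)|=\infty.$$
   Context: In a simple graph $G=(V,E)$ each node represents a server that also acts as a dispatcher, and $\mathcal{N}(u)=\{v\in V: v=u\text{ or }\{u,v\}\in E\}$ (so $u\in\mathcal{N}(u)$) is the set of servers compatible with dispatcher $u$; equivalently, one considers the bipartite graph with dispatcher set $V$, server set $V$ and edges $(u,v)$ with $v\in\mathcal{N}(u)$. Degrees $\deg_n$ are taken in the simple graph $G_n$, so that $|\mathcal{N}_n(v)|=\deg_n(v)+1$. In general, for $\alpha=(a,\lambda_{\min},\mu_{\max})$, $$\mathcal{N}_n^\alpha(u)=\{v\in\mathcal{N}_n(u):\deg_n(v)\le a-1,\ \lambda_n(v)\ge\lambda_{\min}\text{ and }\mu_n(w)\le\mu_{\max}\ \forall w\in\mathcal{N}_n(v)\},$$ and servers $u_n$ (for $n$ in an infinite index set) have a skewed neighborhood if $|\mathcal{N}_n^\alpha(u_n)|\to\infty$ for some fixed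 $\alpha$. Here rates are constant and $\alpha=(2,\lambda,\mu)$, so $\mathcal{N}_n^\alpha(u)=\{v\in\mathcal{N}_n(u):\deg_n(v)\le1\}$. The set $\mathcal{M}$ may depend on the realization of the graphs. *)

theory Defs
  imports "HOL-Probability.Probability" "HOL-Library.Ramsey"
begin

text \<open>A simple graph is given by a vertex set \<open>V\<close> and an edge set \<open>E\<close> contained in \<open>nsets V 2\<close>,
  the set of two-element subsets of \<open>V\<close>.\<close>

definition degree_in :: "'v set \<Rightarrow> 'v set set \<Rightarrow> 'v \<Rightarrow> nat" where
  "degree_in V E u = card {v \<in> V. {u, v} \<in> E}"

text \<open>The servers compatible with dispatcher \<open>u\<close>; note that \<open>u\<close> itself is one of them.\<close>

definition compatible :: "'v set \<Rightarrow> 'v set set \<Rightarrow> 'v \<Rightarrow> 'v set" where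
  "compatible V E u = {v \<in> V. v = u \<or> {u, v} \<in> E}"

definition max_degree_vertex :: "'v set \<Rightarrow> 'v set set \<Rightarrow> 'v \<Rightarrow> bool" where
  "max_degree_vertex V E u \<longleftrightarrow> u \<in> V \<and> (\<forall>v\<in>V. degree_in V E v \<le> degree_in V E u)"

text \<open>\<open>lam\<close> and \<open>mu\<close> are the arrival rates and processing speeds of the individual nodes; the triple
  \<open>\<alpha>\<close> consists of the bound \<open>a\<close>, the minimal arrival rate and the maximal processing speed.
  The bound \<open>a\<close> is real so that \<open>a - 1\<close> is not truncated.\<close>

definition compatible_alpha ::
  "real \<times> real \<times> real \<Rightarrow> 'v set \<Rightarrow> 'v set set \<Rightarrow> ('v \<Rightarrow> real) \<Rightarrow> ('v \<Rightarrow> real) \<Rightarrow> 'v \<Rightarrow> 'v set" where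
  "compatible_alpha \<alpha> V E lam mu u = (case \<alpha> of (a, lam_min, mu_max) \<Rightarrow>
     {v \<in> compatible V E u. real (degree_in V E v) \<le> a - 1 \<and> lam_min \<le> lam v \<and>
        (\<forall>w \<in> compatible V E v. mu w \<le> mu_max)})"

text \<open>The filter \<open>inf sequentially (principal I)\<close> describes \<open>n \<rightarrow> \<infinity>\<close> with \<open>n \<in> I\<close>; it is
  nontrivial exactly when \<open>I\<close> is infinite.\<close>

definition skewed_neighborhood ::
  "nat set \<Rightarrow> (nat \<Rightarrow> 'v set) \<Rightarrow> (nat \<Rightarrow> 'v set set) \<Rightarrow>
   (nat \<Rightarrow> 'v \<Rightarrow> real) \<Rightarrow> (nat \<Rightarrow> 'v \<Rightarrow> real) \<Rightarrow> (nat \<Rightarrow> 'v) \<Rightarrow> bool" where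
  "skewed_neighborhood I V E lam mu u \<longleftrightarrow> infinite I \<and>
     (\<exists>\<alpha>. filterlim (\<lambda>n. card (compatible_alpha \<alpha> (V n) (E n) (lam n) (mu n) (u n)))
        at_top (inf sequentially (principal I)))"

definition erdos_renyi :: "'w measure \<Rightarrow> 'v set \<Rightarrow> real \<Rightarrow> ('w \<Rightarrow> 'v set set) \<Rightarrow> bool" where
  "erdos_renyi M V p E \<longleftrightarrow>
     E \<in> M \<rightarrow>\<^sub>M count_space (Pow (nsets V 2)) \<and>
     prob_space.indep_vars M (\<lambda>_. count_space UNIV) (\<lambda>e \<omega>. e \<in> E \<omega>) (nsets V 2) \<and>
     (\<forall>e \<in> nsets V 2. measure M {\<omega> \<in> space M. e \<in> E \<omega>} = p)"

end

theory Submission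
  imports Defs "HOL-Real_Asymp.Real_Asymp"
begin

text \<open>Let \<open>d = \<lceil>(5/4) log n / log log n\<rceil>\<close>. With \<open>X\<close> the expected number of vertices together with \<open>d\<close> chosen
  neighbours, \<open>X = n\<^bsup>-1/4 + o(1)\<^esup>\<close>, while the probability that a given star with \<open>d\<close> leaves is not connected to
  anything else is about \<open>exp (- d log log n / 2) = n\<^bsup>-5/8 + o(1)\<^esup>\<close>. Hence, for large \<open>n\<close>, with probability at least \<open>1/n\<close> some
  connected component of \<open>G\<^sub>n\<close> is a star with \<open>d\<close> leaves and all vertices outside of it have degree less
  than \<open>d\<close>; then its centre is the only vertex of maximum degree and has \<open>d\<close> neighbours of degree one.
  Since the graphs are independent and the harmonic series diverges, this happens for infinitely many
  \<open>n\<close> by the second Borel--Cantelli lemma. The factor \<open>5/4\<close> could be any number in \<open>(1, 4/3)\<close>.\<close>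

section \<open>Stars and the deterministic structure of a dominating star\<close>

definition star :: "'v \<Rightarrow> 'v set \<Rightarrow> 'v set set" where
  "star v S = (\<lambda>s. {v, s}) ` S"

definition pointed_sets :: "'v set \<Rightarrow> nat \<Rightarrow> ('v \<times> 'v set) set" where
  "pointed_sets V d = (SIGMA v:V. {S. S \<subseteq> V - {v} \<and> card S = d})"

definition touching :: "'v set \<Rightarrow> 'v set \<Rightarrow> 'v set set" where
  "touching V S = {e \<in> nsets V 2. e \<inter> S \<noteq> {}}"

text \<open>The second clause excludes every other pair meeting \<open>insert v S\<close>, so the
  star is a connected component. The third, a degree bound outside, is phrased through stars because
  each of them concerns a fixed set of edges, which suits a union bound.\<close>

definition dominating_star :: "'v set \<Rightarrow> nat \<Rightarrow> 'v \<Rightarrow> 'v set \<Rightarrow> 'v set set \<Rightarrow> bool" where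
  "dominating_star V d v S G \<longleftrightarrow>
     star v S \<subseteq> G \<and> (touching V (insert v S) - star v S) \<inter> G = {} \<and>
     (\<forall>(w, T) \<in> pointed_sets (V - insert v S) d. \<not> star w T \<subseteq> G)"

lemma finite_pointed_sets: "finite V \<Longrightarrow> finite (pointed_sets V d)"
  by (auto simp: pointed_sets_def)

lemma card_pointed_sets:
  assumes "finite V"
  shows "card (pointed_sets V d) = card V * (card V - 1 choose d)"
proof -
  have "card (pointed_sets V d) = (\<Sum>v\<in>V. card {S. S \<subseteq> V - {v} \<and> card S = d})"
    unfolding pointed_sets_def using assms by (intro card_SigmaI) auto
  also have "\<dots> = (\<Sum>v\<in>V. card V - 1 choose d)"
    using assms by (intro sum.cong) (auto simp: n_subsets)
  finally show ?thesis
    by simp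
qed

lemma pointed_setsD:
  assumes "(v, S) \<in> pointed_sets V d"
  shows "v \<in> V" "S \<subseteq> V" "v \<notin> S" "card S = d"
  using assms by (auto simp: pointed_sets_def)

lemma pointed_sets_mono: "U \<subseteq> V \<Longrightarrow> pointed_sets U d \<subseteq> pointed_sets V d"
  by (auto simp: pointed_sets_def)

lemma card_star: "v \<notin> S \<Longrightarrow> card (star v S) = card S"
  unfolding star_def by (intro card_image inj_onI) (auto simp: doubleton_eq_iff)

lemma star_subset_touching:
  "(v, S) \<in> pointed_sets V d \<Longrightarrow> star v S \<subseteq> touching V (insert v S)"
  by (auto simp: star_def touching_def pointed_sets_def)

lemma star_subset_nsets: "(v, S) \<in> pointed_sets V d \<Longrightarrow> star v S \<subseteq> nsets V 2"
  by (auto simp: star_def pointed_sets_def)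

text \<open>Counting ordered pairs with first entry in \<open>S\<close> is crude but enough to bound
  the number of pairs that must be absent for a star to be isolated.\<close>

lemma card_touching_le:
  assumes "finite V" "S \<subseteq> V"
  shows "card (touching V S) \<le> card S * card V"
proof -
  have fin: "finite (S \<times> V)"
    using assms finite_subset by auto
  have "touching V S \<subseteq> (\<lambda>(x, y). {x, y}) ` (S \<times> V)"
    by (fastforce simp: touching_def nsets_2_eq)
  then have "card (touching V S) \<le> card (S \<times> V)"
    using fin by (meson card_image_le card_mono finite_imageI le_trans)
  then show ?thesis
    by (simp add: card_cartesian_product)
qed


lemma dominating_star_degree:
  assumes "finite V" "G \<subseteq> nsets V 2" "(v, S) \<in> pointed_sets V d" "dominating_star V d v S G"
  shows "{x \<in> V. {v, x} \<in> G} = S"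
    and "s \<in> S \<Longrightarrow> degree_in V G s = 1"
    and "w \<in> V - insert v S \<Longrightarrow> degree_in V G w < d"
proof -
  note vS = pointed_setsD[OF assms(3)]
  \<comment> \<open>Isolation leaves two kinds of edges: those with both ends outside
    \<open>insert v S\<close>, and those joining \<open>v\<close> to a leaf.\<close>
  have nbr: "x \<in> V - insert v S \<and> y \<in> V - insert v S \<and> x \<noteq> y \<or> x = v \<and> y \<in> S \<or> y = v \<and> x \<in> S"
    if "{x, y} \<in> G" for x y
  proof (cases "{x, y} \<inter> insert v S = {}")
    case True
    moreover have "{x, y} \<in> nsets V 2"
      using that assms(2) by blast
    ultimately show ?thesis
      by auto
  next
    case False
    with that assms have "{x, y} \<in> star v S"
      by (auto simp: dominating_star_def touching_def)
    then show ?thesis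
      by (auto simp: star_def doubleton_eq_iff)
  qed
  have star: "{v, s} \<in> G" if "s \<in> S" for s
    using assms(4) that by (auto simp: dominating_star_def star_def)
  show nbrs: "{x \<in> V. {v, x} \<in> G} = S"
    using nbr star vS by blast
  show "degree_in V G s = 1" if "s \<in> S"
  proof -
    have "{x \<in> V. {s, x} \<in> G} = {v}"
      using nbr[of s] star[OF that] vS that by (auto simp: insert_commute)
    then show ?thesis
      by (simp add: degree_in_def)
  qed
  show "degree_in V G w < d" if w: "w \<in> V - insert v S"
  proof (rule ccontr)
    assume "\<not> degree_in V G w < d"
    then have "d \<le> card {x \<in> V. {w, x} \<in> G}"
      by (simp add: degree_in_def)
    \<comment> \<open>With \<open>w\<close> as centre, \<open>d\<close> of its neighbours would form
      a star outside \<open>insert v S\<close>, which the third clause forbids.\<close>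
    then obtain T where T: "T \<subseteq> {x \<in> V. {w, x} \<in> G}" "card T = d"
      by (rule obtain_subset_with_card_n)
    have "T \<subseteq> V - insert v S - {w}"
      using T(1) nbr[of w] w by auto
    with w T(2) have "(w, T) \<in> pointed_sets (V - insert v S) d"
      by (simp add: pointed_sets_def)
    moreover have "star w T \<subseteq> G"
      using T(1) by (auto simp: star_def)
    ultimately show False
      using assms(4) by (auto simp: dominating_star_def)
  qed
qed

text \<open>The centre has degree \<open>d\<close>, the vertices outside have smaller degree, and
  the leaves have degree 1, which is where \<open>d \<ge> 2\<close> enters.\<close>

lemma dominating_star_max_degree:
  assumes "finite V" "G \<subseteq> nsets V 2" "(v, S) \<in> pointed_sets V d" "dominating_star V d v S G"
    and "d \<ge> 2" "max_degree_vertex V G u"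
  shows "u = v"
proof (rule ccontr)
  assume "u \<noteq> v"
  note deg = dominating_star_degree[OF assms(1-4)]
  have "degree_in V G v = d"
    using deg(1) pointed_setsD[OF assms(3)] by (simp add: degree_in_def)
  then have "d \<le> degree_in V G u"
    using assms(6) pointed_setsD[OF assms(3)] by (auto simp: max_degree_vertex_def)
  moreover have "degree_in V G u < d"
    using deg(2,3)[of u] \<open>u \<noteq> v\<close> assms(5,6) by (cases "u \<in> S") (auto simp: max_degree_vertex_def)
  ultimately show False
    by simp
qed

text \<open>With constant rates, only the condition of degree at most 2 - 1 = 1 has content, and all
  \<open>d\<close> leaves satisfy it.\<close>

lemma dominating_star_compatible_alpha:
  assumes "finite V" "G \<subseteq> nsets V 2" "(v, S) \<in> pointed_sets V d" "dominating_star V d v S G"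
    and "d \<ge> 2" "max_degree_vertex V G u"
  shows "d \<le> card (compatible_alpha (2, lam, mu) V G (\<lambda>_. lam) (\<lambda>_. mu) u)"
proof -
  note deg = dominating_star_degree[OF assms(1-4)]
  have "S \<subseteq> compatible_alpha (2, lam, mu) V G (\<lambda>_. lam) (\<lambda>_. mu) v"
    using deg(1,2) by (auto simp: compatible_alpha_def compatible_def)
  moreover have "finite (compatible_alpha (2, lam, mu) V G (\<lambda>_. lam) (\<lambda>_. mu) v)"
    using assms(1) by (auto simp: compatible_alpha_def compatible_def)
  ultimately show ?thesis
    using card_mono pointed_setsD(4)[OF assms(3)] dominating_star_max_degree[OF assms] by metis
qed

text \<open>The centre is recovered as the vertex of maximum degree and the leaf set as its
  neighbourhood. Hence different candidates give disjoint events, whose probabilities add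
  up.\<close>

lemma dominating_star_unique:
  assumes "finite V" "G \<subseteq> nsets V 2" "d \<ge> 2"
    and "(v, S) \<in> pointed_sets V d" "dominating_star V d v S G"
    and "(w, T) \<in> pointed_sets V d" "dominating_star V d w T G"
  shows "(v, S) = (w, T)"
proof -
  have "max_degree_vertex V G v"
    unfolding max_degree_vertex_def
  proof (intro conjI ballI)
    show "v \<in> V"
      using pointed_setsD[OF assms(4)] by simp
    fix x assume "x \<in> V"
    moreover have "degree_in V G v = d"
      using dominating_star_degree(1)[OF assms(1,2,4,5)] pointed_setsD[OF assms(4)]
      by (simp add: degree_in_def)
    ultimately show "degree_in V G x \<le> degree_in V G v"
      using dominating_star_degree(2,3)[OF assms(1,2,4,5), of x] assms(3)
      by (cases "x = v"; cases "x \<in> S") auto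
  qed
  then have "v = w"
    using dominating_star_max_degree[OF assms(1,2,6,7,3)] by simp
  then show ?thesis
    using dominating_star_degree(1)[OF assms(1,2,4,5)] dominating_star_degree(1)[OF assms(1,2,6,7)]
    by simp
qed

section \<open>Edge patterns and dominating stars in the random graph\<close>

lemma (in prob_space) erdos_renyi_event:
  assumes "erdos_renyi M V p X"
  shows "{\<omega> \<in> space M. P (X \<omega>)} \<in> events"
proof -
  have X: "X \<in> M \<rightarrow>\<^sub>M count_space (Pow (nsets V 2))"
    using assms by (simp add: erdos_renyi_def)
  have "X -` {G \<in> Pow (nsets V 2). P G} \<inter> space M \<in> events"
    by (rule measurable_sets[OF X]) auto
  moreover have "X -` {G \<in> Pow (nsets V 2). P G} \<inter> space M = {\<omega> \<in> space M. P (X \<omega>)}"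
    using measurable_space[OF X] by auto
  ultimately show ?thesis
    by simp
qed

lemma (in prob_space) erdos_renyi_cylinder:
  assumes er: "erdos_renyi M V p X" and "finite V"
    and AB: "A \<subseteq> nsets V 2" "B \<subseteq> nsets V 2" "A \<inter> B = {}"
  shows "prob {\<omega> \<in> space M. A \<subseteq> X \<omega> \<and> B \<inter> X \<omega> = {}} = p ^ card A * (1 - p) ^ card B"
\<comment> \<open>The empty pattern is separate: an intersection over no indices would be the whole
  type instead of \<open>space M\<close>.\<close>
proof (cases "A \<union> B = {}")
  case True
  then show ?thesis
    by (simp add: prob_space)
next
  case False
  have fin: "finite A" "finite B"
    using AB \<open>finite V\<close> by (auto intro: finite_subset finite_imp_finite_nsets)
  \<comment> \<open>Taking the preimage of the truth value of \<open>e \<in> A\<close> treats both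
    cases at once: the edge is required for \<open>e\<close> in \<open>A\<close> and excluded for
    \<open>e\<close> in \<open>B\<close>.\<close>
  let ?F = "\<lambda>e. (\<lambda>\<omega>. e \<in> X \<omega>) -` {e \<in> A} \<inter> space M"
  have iv: "indep_vars (\<lambda>_. count_space UNIV) (\<lambda>e \<omega>. e \<in> X \<omega>) (nsets V 2)"
    and p: "\<And>e. e \<in> nsets V 2 \<Longrightarrow> prob {\<omega> \<in> space M. e \<in> X \<omega>} = p"
    using er by (auto simp: erdos_renyi_def)
  have "{\<omega> \<in> space M. A \<subseteq> X \<omega> \<and> B \<inter> X \<omega> = {}} = (\<Inter>e\<in>A \<union> B. ?F e)"
    using False AB(3) by blast
  also have "prob \<dots> = (\<Prod>e\<in>A \<union> B. prob (?F e))"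
    using False AB fin by (intro indep_varsD[OF iv]) auto
  also have "\<dots> = (\<Prod>e\<in>A. prob (?F e)) * (\<Prod>e\<in>B. prob (?F e))"
    using AB fin by (intro prod.union_disjoint) auto
  also have "(\<Prod>e\<in>A. prob (?F e)) = (\<Prod>e\<in>A. p)"
  proof (rule prod.cong)
    fix e assume "e \<in> A"
    then have "?F e = {\<omega> \<in> space M. e \<in> X \<omega>}"
      by auto
    with \<open>e \<in> A\<close> AB p show "prob (?F e) = p"
      by auto
  qed simp
  also have "(\<Prod>e\<in>B. prob (?F e)) = (\<Prod>e\<in>B. 1 - p)"
  proof (rule prod.cong)
    fix e assume "e \<in> B"
    then have "?F e = space M - {\<omega> \<in> space M. e \<in> X \<omega>}"
      using AB by auto
    with \<open>e \<in> B\<close> AB p erdos_renyi_event[OF er] show "prob (?F e) = 1 - p"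
      by (auto simp: prob_compl)
  qed simp
  finally show ?thesis
    by simp
qed

text \<open>The probability that a second star of the same size sits on the remaining vertices is controlled by
  a union bound; its edges are disjoint from those fixed by the first star, so only products of
  independent edge events occur.\<close>

lemma (in prob_space) prob_dominating_star_ge:
  assumes er: "erdos_renyi M V p X" and V: "finite V" and vS: "(v, S) \<in> pointed_sets V d"
    and p: "0 \<le> p" "p \<le> 1" and x: "real (card (pointed_sets V d)) * p ^ d \<le> 1"
  shows "p ^ d * (1 - p) ^ ((d + 1) * card V) * (1 - real (card (pointed_sets V d)) * p ^ d)
    \<le> prob {\<omega> \<in> space M. dominating_star V d v S (X \<omega>)}"
proof -
  let ?U = "V - insert v S"
  let ?B = "touching V (insert v S) - star v S"
  let ?star = "{\<omega> \<in> space M. star v S \<subseteq> X \<omega> \<and> ?B \<inter> X \<omega> = {}}"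
  let ?two = "\<lambda>(w, T). {\<omega> \<in> space M. star v S \<union> star w T \<subseteq> X \<omega> \<and> ?B \<inter> X \<omega> = {}}"
  \<comment> \<open>\<open>q\<close> is the exact probability that the star is present and isolated;
    the number of forbidden pairs is estimated only at the end.\<close>
  define q where "q = p ^ d * (1 - p) ^ card ?B"
  note vS' = pointed_setsD[OF vS]
  have B: "?B \<subseteq> nsets V 2"
    by (auto simp: touching_def)
  have prob_star: "prob ?star = q"
    using erdos_renyi_cylinder[OF er V star_subset_nsets[OF vS] B] card_star[OF vS'(3)] vS'(4) by (simp add: q_def)
  have prob_two: "prob (?two (w, T)) = q * p ^ d" if wT: "(w, T) \<in> pointed_sets ?U d" for w T
  proof -
    note wT' = pointed_setsD[OF wT]
    have disj: "star w T \<inter> touching V (insert v S) = {}"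
      using wT' by (auto simp: star_def touching_def)
    have sub: "star w T \<subseteq> nsets V 2"
      using star_subset_nsets[OF wT] nsets_mono[of ?U V 2] by auto
    have fin: "finite S" "finite T"
      using V vS' wT' by (auto intro: finite_subset)
    have "card (star v S \<union> star w T) = card (star v S) + card (star w T)"
      using disj star_subset_touching[OF vS] fin by (intro card_Un_disjoint) (auto simp: star_def)
    then have "card (star v S \<union> star w T) = d + d"
      using card_star[OF vS'(3)] card_star[OF wT'(3)] vS'(4) wT'(4) by simp
    moreover have "prob (?two (w, T)) = p ^ card (star v S \<union> star w T) * (1 - p) ^ card ?B"
      using disj sub star_subset_nsets[OF vS] unfolding prod.case
      by (intro erdos_renyi_cylinder[OF er V _ B]) auto
    ultimately show ?thesis
      by (simp add: q_def power_add)
  qed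
  have "prob (\<Union>wT\<in>pointed_sets ?U d. ?two wT) \<le> (\<Sum>wT\<in>pointed_sets ?U d. prob (?two wT))"
    using V erdos_renyi_event[OF er] by (intro finite_measure_subadditive_finite finite_pointed_sets) auto
  also have "\<dots> = (\<Sum>wT\<in>pointed_sets ?U d. q * p ^ d)"
    using prob_two by (intro sum.cong) auto
  \<comment> \<open>Enlarging \<open>?U\<close> to \<open>V\<close> makes the bound independent of
    the chosen star.\<close>
  also have "\<dots> \<le> real (card (pointed_sets V d)) * (q * p ^ d)"
    using p V unfolding sum_constant q_def
    by (intro mult_right_mono of_nat_mono card_mono finite_pointed_sets pointed_sets_mono) auto
  finally have two: "prob (\<Union>wT\<in>pointed_sets ?U d. ?two wT) \<le> q * (real (card (pointed_sets V d)) * p ^ d)"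
    by (simp add: mult_ac)
  \<comment> \<open>The event is an isolated star minus those outcomes in which a second star
    appears outside it.\<close>
  have "{\<omega> \<in> space M. dominating_star V d v S (X \<omega>)} = ?star - (\<Union>wT\<in>pointed_sets ?U d. ?two wT)"
    by (auto simp: dominating_star_def)
  moreover have "prob (?star - (\<Union>wT\<in>pointed_sets ?U d. ?two wT))
      = prob ?star - prob (\<Union>wT\<in>pointed_sets ?U d. ?two wT)"
    using V erdos_renyi_event[OF er]
    by (intro finite_measure_Diff sets.finite_UN finite_pointed_sets) auto
  ultimately have "q * (1 - real (card (pointed_sets V d)) * p ^ d)
      \<le> prob {\<omega> \<in> space M. dominating_star V d v S (X \<omega>)}"
    using two prob_star by (simp add: right_diff_distrib)
  moreover have "p ^ d * (1 - p) ^ ((d + 1) * card V) \<le> q"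
  proof -
    have "card ?B \<le> card (touching V (insert v S))"
      using V by (intro card_mono) (auto simp: touching_def finite_imp_finite_nsets)
    also have "\<dots> \<le> card (insert v S) * card V"
      using V vS' by (intro card_touching_le) auto
    also have "card (insert v S) = d + 1"
      using vS' finite_subset[OF vS'(2) V] by simp
    finally show ?thesis
      unfolding q_def using p by (intro mult_left_mono power_decreasing) auto
  qed
  \<comment> \<open>By \<open>x\<close> the last factor is nonnegative, so the lower bound for
    \<open>q\<close> may be multiplied by it.\<close>
  then have "p ^ d * (1 - p) ^ ((d + 1) * card V) * (1 - real (card (pointed_sets V d)) * p ^ d)
      \<le> q * (1 - real (card (pointed_sets V d)) * p ^ d)"
    using x by (intro mult_right_mono) auto
  ultimately show ?thesis
    by linarith
qed

text \<open>By uniqueness the events for different candidates are disjoint, so the bound for a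
  single candidate is simply summed and no second moment is involved.\<close>

lemma (in prob_space) prob_ex_dominating_star_ge:
  assumes er: "erdos_renyi M V p X" and V: "finite V" and d: "d \<ge> 2"
    and p: "0 \<le> p" "p \<le> 1" and x: "real (card (pointed_sets V d)) * p ^ d \<le> 1"
  shows "real (card (pointed_sets V d)) * p ^ d * (1 - p) ^ ((d + 1) * card V) *
      (1 - real (card (pointed_sets V d)) * p ^ d)
    \<le> prob {\<omega> \<in> space M. \<exists>(v, S) \<in> pointed_sets V d. dominating_star V d v S (X \<omega>)}"
proof -
  let ?P = "pointed_sets V d"
  let ?F = "\<lambda>(v, S). {\<omega> \<in> space M. dominating_star V d v S (X \<omega>)}"
  have "X \<in> M \<rightarrow>\<^sub>M count_space (Pow (nsets V 2))"
    using er by (simp add: erdos_renyi_def)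
  from measurable_space[OF this] have X: "X \<omega> \<subseteq> nsets V 2" if "\<omega> \<in> space M" for \<omega>
    using that by simp
  have "real (card ?P) * p ^ d * (1 - p) ^ ((d + 1) * card V) * (1 - real (card ?P) * p ^ d)
    = (\<Sum>vS\<in>?P. p ^ d * (1 - p) ^ ((d + 1) * card V) * (1 - real (card ?P) * p ^ d))"
    by simp
  also have "\<dots> \<le> (\<Sum>vS\<in>?P. prob (?F vS))"
  proof (rule sum_mono)
    fix vS assume "vS \<in> ?P"
    then show "p ^ d * (1 - p) ^ ((d + 1) * card V) * (1 - real (card ?P) * p ^ d) \<le> prob (?F vS)"
      using prob_dominating_star_ge[OF er V _ p x] by (cases vS) (simp only: prod.case)
  qed
  also have "\<dots> = prob (\<Union>vS\<in>?P. ?F vS)"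
  proof (rule finite_measure_finite_Union[symmetric])
    show "finite ?P"
      by (rule finite_pointed_sets[OF V])
    show "?F ` ?P \<subseteq> events"
      using erdos_renyi_event[OF er] by auto
    show "disjoint_family_on ?F ?P"
      unfolding disjoint_family_on_def
    proof (intro ballI impI)
      fix a b assume ab: "a \<in> ?P" "b \<in> ?P" "a \<noteq> b"
      obtain v S w T where "a = (v, S)" "b = (w, T)"
        by (cases a, cases b)
      with ab show "?F a \<inter> ?F b = {}"
        using dominating_star_unique[OF V X d, of _ v S w T] by auto
    qed
  qed
  also have "(\<Union>vS\<in>?P. ?F vS) = {\<omega> \<in> space M. \<exists>(v, S) \<in> ?P. dominating_star V d v S (X \<omega>)}"
    by auto
  finally show ?thesis .
qed

section \<open>The second Borel-Cantelli lemma\<close>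

text \<open>Independence is assumed from index \<open>k\<close> on; the finitely many earlier terms
  do not affect divergence. The probability that no event occurs from \<open>m\<close> on is at most
  \<open>exp\<close> of minus any partial sum, by \<open>1 - x \<le> exp (- x)\<close>.\<close>

lemma (in prob_space) borel_cantelli_AE2:
  assumes indep: "indep_events A {k..}" and diverges: "\<not> summable (\<lambda>n. prob (A n))"
  shows "AE \<omega> in M. infinite {n. n \<ge> k \<and> \<omega> \<in> A n}"
proof -
  have meas: "A n \<in> events" if "n \<ge> k" for n
    using indep that by (auto simp: indep_events_def)
  define P where "P = (\<lambda>n. prob (A n))"
  have null: "(\<Inter>n\<in>{m..}. space M - A n) \<in> null_sets M" if "m \<ge> k" for m
  proof -
    let ?B = "\<Inter>n\<in>{m..}. space M - A n"
    have B: "?B \<in> events"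
      using that meas by (intro sets.countable_INT') auto
    have compl: "indep_events (\<lambda>n. space M - A n) {k..}"
    proof -
      \<comment> \<open>A single set is trivially stable under intersection, so independence passes
        to the generated sigma-algebras, which contain the complements.\<close>
      have "indep_sets (\<lambda>n. sigma_sets (space M) {A n}) {k..}"
        using indep unfolding indep_events_def_alt by (rule indep_sets_sigma) (simp add: Int_stable_def)
      then show ?thesis
        unfolding indep_events_def_alt
        by (rule indep_sets_mono_sets) (auto intro: sigma_sets.Compl)
    qed
    have prod: "prob (\<Inter>n\<in>{m..m+N}. space M - A n) = (\<Prod>n\<in>{m..m+N}. 1 - P n)" for N
    proof -
      have "{m..m+N} \<subseteq> {k..}" "{m..m+N} \<noteq> {}" "finite {m..m+N}"
        using that by auto
      with compl have "prob (\<Inter>n\<in>{m..m+N}. space M - A n) = (\<Prod>n\<in>{m..m+N}. prob (space M - A n))"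
        unfolding indep_events_def by blast
      also have "\<dots> = (\<Prod>n\<in>{m..m+N}. 1 - P n)"
        using that meas by (intro prod.cong) (auto simp: P_def prob_compl)
      finally show ?thesis .
    qed
    have le: "prob ?B \<le> exp (- (\<Sum>n=m..m+N. P n))" for N
    proof -
      have "prob ?B \<le> prob (\<Inter>n\<in>{m..m+N}. space M - A n)"
        using that meas by (intro finite_measure_mono sets.finite_INT) auto
      also have "\<dots> \<le> (\<Prod>n\<in>{m..m+N}. exp (- P n))"
        unfolding prod
      proof (rule prod_mono)
        show "0 \<le> 1 - P n \<and> 1 - P n \<le> exp (- P n)" for n
          using exp_ge_add_one_self[of "- P n"] by (simp add: P_def)
      qed
      finally show ?thesis
        by (simp add: exp_sum flip: sum_negf)
    qed
    have "prob ?B = 0"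
    proof (rule ccontr)
      assume "prob ?B \<noteq> 0"
      then have pos: "prob ?B > 0"
        by (simp add: zero_less_measure_iff)
      \<comment> \<open>A positive probability would bound all partial sums from \<open>m\<close>
        on, contradicting divergence.\<close>
      have bound: "(\<Sum>n=m..m+N. P n) \<le> - ln (prob ?B)" for N
      proof -
        have "ln (prob ?B) \<le> ln (exp (- (\<Sum>n=m..m+N. P n)))"
          by (intro ln_mono le pos)
        then show ?thesis
          by simp
      qed
      have "summable (\<lambda>n. P (n + m))"
      proof (rule summableI_nonneg_bounded)
        show "(\<Sum>i<N. P (i + m)) \<le> - ln (prob ?B)" for N
        proof -
          have "(\<Sum>i<N. P (i + m)) = (\<Sum>i\<in>{m..<N+m}. P i)"
            using sum.shift_bounds_nat_ivl[of P 0 m N] by (simp add: lessThan_atLeast0)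
          also have "\<dots> \<le> (\<Sum>n=m..m+N. P n)"
            by (intro sum_mono2) (auto simp: P_def)
          also note bound
          finally show ?thesis .
        qed
      qed (simp add: P_def)
      then have "summable P"
        by (rule summable_iff_shift[THEN iffD1])
      with diverges show False
        by (simp add: P_def)
    qed
    with B show ?thesis
      by (auto simp: null_sets_def emeasure_eq_measure)
  qed
  have "(\<Union>m\<in>{k..}. \<Inter>n\<in>{m..}. space M - A n) \<in> null_sets M"
    using null by (intro null_sets_UN') auto
  then show ?thesis
  proof (rule AE_I', intro subsetI)
    fix \<omega> assume "\<omega> \<in> {\<omega> \<in> space M. \<not> infinite {n. k \<le> n \<and> \<omega> \<in> A n}}"
    then have w: "\<omega> \<in> space M" "finite {n. k \<le> n \<and> \<omega> \<in> A n}"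
      by auto
    then obtain m where "\<forall>n\<in>{n. k \<le> n \<and> \<omega> \<in> A n}. n < m"
      using finite_nat_set_iff_bounded by blast
    then have "\<omega> \<in> space M - A n" if "n \<ge> max k m" for n
      using w that by fastforce
    then show "\<omega> \<in> (\<Union>m\<in>{k..}. \<Inter>n\<in>{m..}. space M - A n)"
      by (intro UN_I[of "max k m"] INT_I) auto
  qed
qed

section \<open>Asymptotics of the star size and of the probability bounds\<close>

text \<open>The left side over \<open>fact d\<close> is one term of the exponential series at
  \<open>d\<close>. This is the easy half of Stirling's formula.\<close>

lemma power_le_exp_mult_fact: "real d ^ d \<le> exp (real d) * fact d"
proof -
  have "real d ^ d /\<^sub>R fact d \<le> (\<Sum>k. real d ^ k /\<^sub>R fact k)"
    using sum_le_suminf[OF sums_summable[OF exp_converges[of "real d"]], of "{d}"] by simp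
  also have "\<dots> = exp (real d)"
    by (rule sums_unique[OF exp_converges, symmetric])
  finally show ?thesis
    by (simp add: field_simps)
qed

definition edge_prob :: "nat \<Rightarrow> real" where
  "edge_prob n = ln (ln (real n)) / (2 * (real n - 1))"

definition star_size :: "nat \<Rightarrow> nat" where
  "star_size n = nat \<lceil>5/4 * ln (real n) / ln (ln (real n))\<rceil>"

definition expected_stars :: "nat \<Rightarrow> real" where
  "expected_stars n = real n * real (n - 1 choose star_size n) * edge_prob n ^ star_size n"

lemma star_size_at_top: "filterlim star_size at_top sequentially"
proof -
  have "filterlim (\<lambda>n. 5/4 * ln (real n) / ln (ln (real n))) at_top sequentially"
    by real_asymp
  then show ?thesis
    unfolding filterlim_sequentially_iff_filterlim_real star_size_def
    by (rule filterlim_at_top_mono) (auto intro!: always_eventually real_nat_ceiling_ge)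
qed

text \<open>With factor c in place of 5/4, the expected number is n to the power 1 - c + o(1), which
  tends to 0 for c > 1. Isolation costs a further c/2 in the exponent, and 1 - 3c/2 > -1 means c <
  4/3. The 2 in \<open>2 / real n\<close> pays for the later factor
  \<open>1 - expected_stars n \<ge> 1/2\<close>.\<close>

lemma eventually_expected_stars:
  "\<forall>\<^sub>F n in sequentially. edge_prob n \<in> {0..1} \<and> expected_stars n \<le> 1/2 \<and>
     2 / real n \<le> expected_stars n * (1 - edge_prob n) ^ ((star_size n + 1) * n)"
proof -
  define L where "L n = ln (ln (real n))" for n
  define t where "t n = 5/4 * ln (real n) / L n" for n
  \<comment> \<open>\<open>t\<close> is the star size before rounding and \<open>L n / 2\<close> the
    mean degree. This is the logarithm of the upper estimate by 1/2.\<close>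
  have upper: "\<forall>\<^sub>F n in sequentially. ln (real n) + t n * (1 + ln (L n / 2) - ln (t n)) \<le> - ln 2"
    unfolding t_def L_def by real_asymp
  \<comment> \<open>Rounding up gives \<open>t n + 1\<close> as a bound for the star size and
    \<open>t n + 2\<close> for the star size plus one. One \<open>ln (real n)\<close> comes from the
    choice of the centre, the other from the target \<open>2 / real n\<close>.\<close>
  have lower: "\<forall>\<^sub>F n in sequentially. ln 2 \<le> 2 * ln (real n) - (t n + 1) * ln (t n + 1)
      + (t n + 2) * real n * ln (1 - edge_prob n)"
    unfolding t_def L_def edge_prob_def by real_asymp
  \<comment> \<open>In turn these give mean degree at least 1, a base at most 1 in the power
    estimate, a star that fits into the graph, and a defined logarithm of
    \<open>1 - edge_prob n\<close>.\<close>
  have "\<forall>\<^sub>F n in sequentially. L n \<ge> 2" "\<forall>\<^sub>F n in sequentially. t n \<ge> L n / 2 * exp 1"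
    "\<forall>\<^sub>F n in sequentially. t n + 1 \<le> real n - 1" "\<forall>\<^sub>F n in sequentially. edge_prob n < 1"
    unfolding t_def L_def edge_prob_def by real_asymp+
  with upper lower eventually_ge_at_top[of 3] show ?thesis
  proof eventually_elim
    case (elim n)
    let ?p = "edge_prob n" and ?d = "star_size n" and ?c = "L n / 2"
    have c: "?c \<ge> 1" and n: "real n \<ge> 3"
      using elim by auto
    have cp: "(real n - 1) * ?p = ?c"
      using n by (simp add: edge_prob_def L_def field_simps)
    have "0 < (real n - 1) * ?p"
      unfolding cp using c by simp
    then have p0: "?p > 0"
      using n by (simp add: zero_less_mult_iff)
    have t: "t n > 0"
      using elim c by (smt (verit) exp_gt_zero mult_pos_pos)
    have td: "t n \<le> real ?d" "real ?d \<le> t n + 1"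
      using t unfolding star_size_def t_def L_def by linarith+
    have d0: "real ?d > 0"
      using t td by linarith
    have dn: "?d \<le> n - 1"
      using td elim by linarith
    have n1: "real (n - 1) = real n - 1"
      using n by linarith

    have "real (n - 1 choose ?d) \<le> (real n - 1) ^ ?d / fact ?d"
    proof -
      have "real ((n - 1 choose ?d) * fact ?d) \<le> real ((n - 1) ^ ?d)"
        by (intro of_nat_mono binomial_fact_pow)
      then show ?thesis
        by (simp only: of_nat_mult of_nat_power of_nat_fact n1 pos_le_divide_eq fact_gt_zero)
    qed
    then have "real (n - 1 choose ?d) * ?p ^ ?d \<le> (real n - 1) ^ ?d / fact ?d * ?p ^ ?d"
      using p0 by (intro mult_right_mono) auto
    also have "\<dots> = ?c ^ ?d / fact ?d"
      by (simp flip: cp add: power_mult_distrib)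
    also have "\<dots> \<le> (?c * exp 1 / real ?d) ^ ?d"
    proof -
      have "real ?d ^ ?d * ?c ^ ?d \<le> (exp (real ?d) * fact ?d) * ?c ^ ?d"
        using c by (intro mult_right_mono power_le_exp_mult_fact) auto
      then show ?thesis
        using d0 by (simp add: field_simps flip: exp_of_nat_mult)
    qed
    also have "\<dots> \<le> (?c * exp 1 / t n) ^ ?d"
      using td t c by (intro power_mono divide_left_mono mult_pos_pos) auto
    also have "\<dots> = (?c * exp 1 / t n) powr real ?d"
      using t c by (subst powr_realpow) auto
    \<comment> \<open>The base is at most 1, so lowering the exponent from \<open>?d\<close> to
      \<open>t n\<close> increases the power.\<close>
    also have "\<dots> \<le> (?c * exp 1 / t n) powr t n"
      using t c td elim by (intro powr_mono') auto
    also have "\<dots> = exp (t n * (1 + ln ?c - ln (t n)))"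
      using t c by (simp add: powr_def ln_mult ln_div algebra_simps)
    finally have "expected_stars n \<le> real n * exp (t n * (1 + ln ?c - ln (t n)))"
      unfolding expected_stars_def using n by (simp add: mult.assoc)
    also have "\<dots> = exp (ln (real n) + t n * (1 + ln ?c - ln (t n)))"
      using n by (simp add: exp_add)
    also have "\<dots> \<le> exp (- ln 2)"
      using elim by (subst exp_le_cancel_iff)
    finally have up: "expected_stars n \<le> 1/2"
      by (simp add: exp_minus)

    have "(real ?d) * ln (real ?d) \<le> (t n + 1) * ln (t n + 1)"
      using td d0 t elim by (intro mult_mono) (auto simp: star_size_def)
    moreover have "0 \<le> real ?d * ln ?c"
      using c by simp
    \<comment> \<open>The logarithm is negative, so the larger multiplicity gives the smaller
      value.\<close>
    moreover have "(t n + 2) * real n * ln (1 - ?p) \<le> (real ?d + 1) * real n * ln (1 - ?p)"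
      using td n p0 elim by (intro mult_right_mono_neg mult_right_mono) auto
    moreover have "real ?d * (ln ?c - ln (real ?d)) = real ?d * ln ?c - real ?d * ln (real ?d)"
      by (rule right_diff_distrib)
    ultimately have exponent: "ln 2 - ln (real n)
        \<le> ln (real n) + real ?d * (ln ?c - ln (real ?d)) + (real ?d + 1) * real n * ln (1 - ?p)"
      using elim by linarith
    have "2 / real n = exp (ln 2 - ln (real n))"
      using n by (simp add: exp_diff)
    also have "\<dots> \<le> exp (ln (real n) + real ?d * (ln ?c - ln (real ?d)) + (real ?d + 1) * real n * ln (1 - ?p))"
      using exponent by simp
    also have "\<dots> = real n * (?c / real ?d) ^ ?d * (1 - ?p) ^ ((?d + 1) * n)"
    proof -
      have "exp ((real ?d + 1) * real n * ln (1 - ?p)) = (1 - ?p) ^ ((?d + 1) * n)"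
        using elim exp_of_nat_mult[of "(?d + 1) * n" "ln (1 - ?p)"] by (simp add: algebra_simps)
      moreover have "exp (real ?d * (ln ?c - ln (real ?d))) = (?c / real ?d) ^ ?d"
        using c d0 by (subst exp_of_nat_mult) (simp add: exp_diff)
      ultimately show ?thesis
        using n by (simp add: exp_add)
    qed
    also have "\<dots> = real n * ((real (n - 1) / real ?d) ^ ?d * ?p ^ ?d) * (1 - ?p) ^ ((?d + 1) * n)"
      unfolding n1 by (simp flip: cp power_mult_distrib)
    also have "\<dots> \<le> real n * (real (n - 1 choose ?d) * ?p ^ ?d) * (1 - ?p) ^ ((?d + 1) * n)"
      using elim p0 n dn by (intro mult_right_mono mult_left_mono binomial_ge_n_over_k_pow_k) auto
    finally have "2 / real n \<le> expected_stars n * (1 - ?p) ^ ((?d + 1) * n)"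
      by (simp add: expected_stars_def mult.assoc)
    with up p0 elim show ?case
      by simp
  qed
qed

section \<open>Infinitely many dominating stars and the limit along them\<close>

theorem theorem5:
  fixes M :: "'w measure"
    and V :: "nat \<Rightarrow> 'v set"
    and E :: "nat \<Rightarrow> 'w \<Rightarrow> 'v set set"
    and u :: "nat \<Rightarrow> 'w \<Rightarrow> 'v"
    and lam mu :: real
  assumes "prob_space M"
    and "0 < lam" and "lam < mu"
    and "\<And>n. n \<ge> 3 \<Longrightarrow> finite (V n) \<and> card (V n) = n"
    and "\<And>n. n \<ge> 3 \<Longrightarrow> erdos_renyi M (V n) (ln (ln (real n)) / (2 * (real n - 1))) (E n)"
    and "prob_space.indep_vars M (\<lambda>n. count_space (Pow (nsets (V n) 2))) E {3..}"
    and "\<And>n \<omega>. n \<ge> 3 \<Longrightarrow> \<omega> \<in> space M \<Longrightarrow> max_degree_vertex (V n) (E n \<omega>) (u n \<omega>)"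
  shows "AE \<omega> in M. \<exists>I \<subseteq> {3..}. infinite I \<and>
     skewed_neighborhood I V (\<lambda>n. E n \<omega>) (\<lambda>_ _. lam) (\<lambda>_ _. mu) (\<lambda>n. u n \<omega>) \<and>
     filterlim (\<lambda>m. card (compatible_alpha (2, lam, mu) (V m) (E m \<omega>) (\<lambda>_. lam) (\<lambda>_. mu) (u m \<omega>)))
       at_top (inf sequentially (principal I))"
proof -
  interpret prob_space M by fact
  note V = assms(4) and indep = assms(6) and maxdeg = assms(7)
  have er: "erdos_renyi M (V n) (edge_prob n) (E n)" if "n \<ge> 3" for n
    using assms(5)[OF that] by (simp add: edge_prob_def)
  let ?Q = "\<lambda>n G. \<exists>(v, S) \<in> pointed_sets (V n) (star_size n). dominating_star (V n) (star_size n) v S G"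
  define A where "A n = {\<omega> \<in> space M. ?Q n (E n \<omega>)}" for n
  \<comment> \<open>Each \<open>A n\<close> depends on the graph \<open>E n\<close> alone, so
    independence of the graphs carries over.\<close>
  have "indep_events A {3..}"
    unfolding A_def by (rule indep_eventsI_indep_vars[OF indep]) auto
  moreover have "\<not> summable (\<lambda>n. prob (A n))"
  proof
    assume "summable (\<lambda>n. prob (A n))"
    moreover have "\<forall>\<^sub>F n in sequentially. star_size n \<ge> 2"
      using star_size_at_top by (simp add: filterlim_at_top)
    with eventually_expected_stars eventually_ge_at_top[of 3]
    have "\<forall>\<^sub>F n in sequentially. norm (inverse (real n)) \<le> prob (A n)"
    proof eventually_elim
      case (elim n)
      let ?r = "(1 - edge_prob n) ^ ((star_size n + 1) * n)"
      have x: "real (card (pointed_sets (V n) (star_size n))) * edge_prob n ^ star_size n = expected_stars n"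
        using V[of n] elim by (simp add: card_pointed_sets expected_stars_def)
      \<comment> \<open>Comparison with the harmonic series; the factor 1/2 is matched with
        \<open>1 - expected_stars n\<close>.\<close>
      have "norm (inverse (real n)) = (2 / real n) * (1 / 2)"
        by (simp add: inverse_eq_divide)
      also have "\<dots> \<le> expected_stars n * ?r * (1 - expected_stars n)"
        using elim by (intro mult_mono) (auto intro: order_trans[of 0 "2 / real n"])
      also have "\<dots> \<le> prob (A n)"
        using prob_ex_dominating_star_ge[OF er, of n "star_size n"] V[of n] elim
        unfolding A_def x by simp
      finally show ?case .
    qed
    ultimately have "summable (\<lambda>n. inverse (real n))"
      by (rule summable_comparison_test_ev[rotated])
    then show False
      using not_summable_harmonic[where 'a = real] by simp
  qed
  ultimately have "AE \<omega> in M. infinite {n. n \<ge> 3 \<and> \<omega> \<in> A n}"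
    by (rule borel_cantelli_AE2)
  then show ?thesis
  proof (rule AE_mp, intro AE_I2 impI)
    fix \<omega> assume w: "\<omega> \<in> space M" and inf: "infinite {n. n \<ge> 3 \<and> \<omega> \<in> A n}"
    define I where "I = {n. n \<ge> 3 \<and> \<omega> \<in> A n}"
    let ?c = "\<lambda>m. card (compatible_alpha (2, lam, mu) (V m) (E m \<omega>) (\<lambda>_. lam) (\<lambda>_. mu) (u m \<omega>))"
    \<comment> \<open>The centre is the only vertex of maximum degree, so the bound holds whatever
      the selection \<open>u\<close>.\<close>
    have c: "star_size m \<le> ?c m" if mI: "m \<in> I" and d: "star_size m \<ge> 2" for m
    proof -
      have m: "m \<ge> 3"
        using mI by (simp add: I_def)
      have "E m \<in> M \<rightarrow>\<^sub>M count_space (Pow (nsets (V m) 2))"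
        using er[OF m] by (simp add: erdos_renyi_def)
      from measurable_space[OF this w] have sub: "E m \<omega> \<subseteq> nsets (V m) 2"
        by simp
      obtain v S where "(v, S) \<in> pointed_sets (V m) (star_size m)"
        and "dominating_star (V m) (star_size m) v S (E m \<omega>)"
        using mI unfolding I_def A_def by blast
      then show ?thesis
        using V[OF m] sub maxdeg[OF m w] d by (intro dominating_star_compatible_alpha) auto
    qed
    have lim: "filterlim ?c at_top (inf sequentially (principal I))"
    proof (rule filterlim_at_top_mono)
      show "filterlim star_size at_top (inf sequentially (principal I))"
        by (rule filterlim_mono[OF star_size_at_top]) auto
      have "\<forall>\<^sub>F n in sequentially. star_size n \<ge> 2"
        using star_size_at_top by (simp add: filterlim_at_top)
      \<comment> \<open>Only eventually are there two leaves, so the comparison is eventual along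
        \<open>I\<close>.\<close>
      then show "\<forall>\<^sub>F m in inf sequentially (principal I). star_size m \<le> ?c m"
        unfolding eventually_inf_principal by eventually_elim (use c in auto)
    qed
    have "infinite I"
      using inf by (simp add: I_def)
    with lim show "\<exists>I \<subseteq> {3..}. infinite I \<and>
        skewed_neighborhood I V (\<lambda>n. E n \<omega>) (\<lambda>_ _. lam) (\<lambda>_ _. mu) (\<lambda>n. u n \<omega>) \<and>
        filterlim ?c at_top (inf sequentially (principal I))"
      unfolding skewed_neighborhood_def by (intro exI[of _ I] conjI exI[of _ "(2, lam, mu)"]) (auto simp: I_def)
  qed
qed

end
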